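(* Let $(X,d_\eta)$ be a complete $\eta$-cone metric space such that $d_\eta$ is continuous. Suppose the mapping $T:X\to X$ satisfies, for some $k\in[0,1)$, the contractive condition $$d_\eta(Tx,Ty)\preceq k\, d_\eta(x,y)\quad\text{for all } x,y\in X.$$ Moreover, suppose that for every $x_0\in X$, writing $x_n=T^nx_0$ for $n\ge 0$, the double limit $\lim_{n,m\to\infty}\eta(x_n,x_m)$ exists and satisfies $\lim_{n,m\to\infty}\eta(x_n,x_m)<\frac1k$ (where $\frac1k$ is read as $+\infty$ if $k=0$). Then $T$ has exactly one fixed point $x^*$. Moreover, for each $x\in X$, $T^nx\to x^*$.
   Context: Let $E$ be a real Banach space with norm $\|\cdot\|$ and zero vector $\theta$. A subset $P\subset E$ is a cone if: $P$ is closed, nonempty and $P\neq\{\theta\}$; $ax+by\in P$ for all $x,y\in P$ and all real $a,b\ge 0$; and $x\in P$, $-x\in P$ imply $x=\theta$. Write $x\preceq y$ iff $y-x\in P$, and $x\ll y$ iff $y-x\in \mathrm{Int}(P)$ (the interior of $P$). The cone $P$ is normal if there is a real $C>0$ such that $\theta\preceq x\preceq y$ implies $\|x\|\le C\|y\|$ for all $x,y \in E$; the least such positive number $K$ is the normal constant. Standing assumption: $P$ is a normal cone with normal constant $K$ and $\mathrm{Int}(P)\ne\emptyset$. Let $X$ be a nonempty set and $\eta:X\times X\to[1,\infty)$ a map. A function $d_\eta:X\times X\to E$ is an $\eta$-cone metric on $X$, and $(X,d_\eta)$ an $\eta$-cone metric space, if for all $x,y,z\in X$: (d1) $\theta\preceq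 d_\eta(x,y)$, and $d_\eta(x,y)=\theta$ iff $x=y$; (d2) $d_\eta(x,y)=d_\eta(y,x)$; (d3) $d_\eta(x,z)\preceq\eta(x,z)[d_\eta(x,y)+d_\eta(y,z)]$. A sequence $(x_n)$ in $X$ converges to $x\in X$ (written $x_n\to x$) if for every $c\in E$ with $c\gg\theta$ there is $n_0\in\mathbb N$ with $d_\eta(x_n,x)\ll c$ for all $n\ge n_0$. It is Cauchy if for every $c\gg\theta$ there is $n_0$ with $d_\eta(x_n,x_m)\ll c$ for all $n,m\ge n_0$. The space is complete if every Cauchy sequence converges in $X$. The natural topology on $X$ is $\mathcal T_\eta=\{U\subset X:\forall x\in U,\ \exists c\gg\theta,\ B_\eta(x,c)\subset U\}$, where $B_\eta(x,c)=\{y\in X: d_\eta(x,y)\ll c\}$. "$d_\eta$ is continuous" means continuous as a map $X\times X\to E$, where $X\times X$ has the product of the natural topologies and $E$ the norm topology. *)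

theory Defs
  imports "HOL-Analysis.Analysis"
begin

definition ordering_cone :: "'e::banach set \<Rightarrow> bool" where
  "ordering_cone P \<longleftrightarrow>
     closed P \<and> P \<noteq> {} \<and> P \<noteq> {0} \<and>
     (\<forall>x\<in>P. \<forall>y\<in>P. \<forall>a\<ge>0. \<forall>b\<ge>0. a *\<^sub>R x + b *\<^sub>R y \<in> P) \<and>
     (\<forall>x. x \<in> P \<and> - x \<in> P \<longrightarrow> x = 0)"

definition cone_le :: "'e::banach set \<Rightarrow> 'e \<Rightarrow> 'e \<Rightarrow> bool" where
  "cone_le P x y \<longleftrightarrow> y - x \<in> P"

definition cone_ll :: "'e::banach set \<Rightarrow> 'e \<Rightarrow> 'e \<Rightarrow> bool" where
  "cone_ll P x y \<longleftrightarrow> y - x \<in> interior P"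

definition normal_bound :: "'e::banach set \<Rightarrow> real \<Rightarrow> bool" where
  "normal_bound P C \<longleftrightarrow>
     C > 0 \<and> (\<forall>x y. cone_le P 0 x \<and> cone_le P x y \<longrightarrow> norm x \<le> C * norm y)"

definition normal_cone :: "'e::banach set \<Rightarrow> bool" where
  "normal_cone P \<longleftrightarrow> ordering_cone P \<and> (\<exists>C. normal_bound P C)"

definition is_normal_constant :: "'e::banach set \<Rightarrow> real \<Rightarrow> bool" where
  "is_normal_constant P K \<longleftrightarrow> normal_bound P K \<and> (\<forall>C. normal_bound P C \<longrightarrow> K \<le> C)"

text \<open>The underlying set is a carrier \<open>X\<close> inside a type; \<open>\<eta>\<close> and \<open>d\<close> are total
  functions whose values are only relevant on \<open>X\<close>.\<close>

definition eta_cone_metric ::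
    "'e::banach set \<Rightarrow> 'a set \<Rightarrow> ('a \<Rightarrow> 'a \<Rightarrow> real) \<Rightarrow> ('a \<Rightarrow> 'a \<Rightarrow> 'e) \<Rightarrow> bool" where
  "eta_cone_metric P X \<eta> d \<longleftrightarrow>
     X \<noteq> {} \<and>
     (\<forall>x\<in>X. \<forall>y\<in>X. 1 \<le> \<eta> x y) \<and>
     (\<forall>x\<in>X. \<forall>y\<in>X. cone_le P 0 (d x y) \<and> (d x y = 0 \<longleftrightarrow> x = y)) \<and>
     (\<forall>x\<in>X. \<forall>y\<in>X. d x y = d y x) \<and>
     (\<forall>x\<in>X. \<forall>y\<in>X. \<forall>z\<in>X. cone_le P (d x z) (\<eta> x z *\<^sub>R (d x y + d y z)))"

definition cone_converges ::
    "'e::banach set \<Rightarrow> ('a \<Rightarrow> 'a \<Rightarrow> 'e) \<Rightarrow> (nat \<Rightarrow> 'a) \<Rightarrow> 'a \<Rightarrow> bool" where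
  "cone_converges P d s x \<longleftrightarrow>
     (\<forall>c. cone_ll P 0 c \<longrightarrow> (\<exists>n0. \<forall>n\<ge>n0. cone_ll P (d (s n) x) c))"

definition cone_Cauchy ::
    "'e::banach set \<Rightarrow> ('a \<Rightarrow> 'a \<Rightarrow> 'e) \<Rightarrow> (nat \<Rightarrow> 'a) \<Rightarrow> bool" where
  "cone_Cauchy P d s \<longleftrightarrow>
     (\<forall>c. cone_ll P 0 c \<longrightarrow> (\<exists>n0. \<forall>n\<ge>n0. \<forall>m\<ge>n0. cone_ll P (d (s n) (s m)) c))"

definition cone_complete ::
    "'e::banach set \<Rightarrow> 'a set \<Rightarrow> ('a \<Rightarrow> 'a \<Rightarrow> 'e) \<Rightarrow> bool" where
  "cone_complete P X d \<longleftrightarrow>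
     (\<forall>s. (\<forall>n. s n \<in> X) \<and> cone_Cauchy P d s \<longrightarrow> (\<exists>x\<in>X. cone_converges P d s x))"

definition cone_ball ::
    "'e::banach set \<Rightarrow> 'a set \<Rightarrow> ('a \<Rightarrow> 'a \<Rightarrow> 'e) \<Rightarrow> 'a \<Rightarrow> 'e \<Rightarrow> 'a set" where
  "cone_ball P X d x c = {y \<in> X. cone_ll P (d x y) c}"

definition natural_topology ::
    "'e::banach set \<Rightarrow> 'a set \<Rightarrow> ('a \<Rightarrow> 'a \<Rightarrow> 'e) \<Rightarrow> 'a topology" where
  "natural_topology P X d =
     topology (\<lambda>U. U \<subseteq> X \<and> (\<forall>x\<in>U. \<exists>c. cone_ll P 0 c \<and> cone_ball P X d x c \<subseteq> U))"

definition cone_metric_continuous ::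
    "'e::banach set \<Rightarrow> 'a set \<Rightarrow> ('a \<Rightarrow> 'a \<Rightarrow> 'e) \<Rightarrow> bool" where
  "cone_metric_continuous P X d \<longleftrightarrow>
     continuous_map (prod_topology (natural_topology P X d) (natural_topology P X d))
       euclidean (\<lambda>(x, y). d x y)"

text \<open>The operator \<^const>\<open>topology\<close> is unspecified on predicates that do not satisfy
  \<^const>\<open>istopology\<close>; the following facts show that this does not happen here.\<close>

lemma interior_cone_add:
  assumes P: "ordering_cone P" and a: "a \<in> interior P" and b: "b \<in> P"
  shows "a + b \<in> interior P"
proof -
  have sub: "(\<lambda>x. b + x) ` interior P \<subseteq> P"
  proof
    fix z assume "z \<in> (\<lambda>x. b + x) ` interior P"
    then obtain x where "x \<in> P" "z = b + x" using interior_subset by blast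
    moreover have "1 *\<^sub>R b + 1 *\<^sub>R x \<in> P"
      using P b \<open>x \<in> P\<close> unfolding ordering_cone_def by (meson zero_le_one)
    ultimately show "z \<in> P" by simp
  qed
  have "open ((\<lambda>x. b + x) ` interior P)"
    by (simp add: open_translation)
  then have "(\<lambda>x. b + x) ` interior P \<subseteq> interior P"
    using sub by (simp add: interior_maximal)
  then show ?thesis using a by (auto simp: add.commute)
qed

lemma cone_ll_common_lower:
  assumes P: "ordering_cone P" and c: "cone_ll P 0 c" and e: "cone_ll P 0 e"
  shows "\<exists>f. cone_ll P 0 f \<and> cone_le P f c \<and> cone_le P f e"
proof -
  have c': "c \<in> interior P" and e': "e \<in> interior P"
    using c e by (auto simp: cone_ll_def)
  have "((\<lambda>t. e - t *\<^sub>R c) \<longlongrightarrow> e - 0 *\<^sub>R c) (at_right 0)"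
    by (intro tendsto_intros)
  then have "\<forall>\<^sub>F t in at_right (0::real). e - t *\<^sub>R c \<in> interior P"
    using e' by (auto dest!: topological_tendstoD[OF _ open_interior])
  moreover have "\<forall>\<^sub>F t in at_right (0::real). 0 < t \<and> t < 1"
    by (auto simp: eventually_at_right_field intro!: exI[of _ 1])
  ultimately have "\<forall>\<^sub>F t in at_right (0::real). e - t *\<^sub>R c \<in> interior P \<and> 0 < t \<and> t < 1"
    by (rule eventually_conj)
  then obtain t :: real where t: "e - t *\<^sub>R c \<in> interior P" "0 < t" "t < 1"
    by (metis (mono_tags, lifting) eventually_happens trivial_limit_at_right_real)
  have cP: "c \<in> P" and eP: "e - t *\<^sub>R c \<in> P"
    using c' t interior_subset by blast+
  have scale: "a *\<^sub>R x \<in> P" if "x \<in> P" "a \<ge> 0" for a x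
  proof -
    have "a *\<^sub>R x + 0 *\<^sub>R x \<in> P"
      using P that unfolding ordering_cone_def by (meson order_refl)
    then show ?thesis by simp
  qed
  have "(\<lambda>x. t *\<^sub>R x) ` interior P \<subseteq> P"
    using scale t interior_subset by fastforce
  moreover have "open ((\<lambda>x. t *\<^sub>R x) ` interior P)"
    using t by (intro open_scaling) auto
  ultimately have "t *\<^sub>R c \<in> interior P"
    using c' by (meson image_eqI interior_maximal subsetD)
  moreover have "c - t *\<^sub>R c \<in> P"
    using scale[OF cP, of "1 - t"] t by (simp add: algebra_simps)
  ultimately show ?thesis
    using eP by (auto simp: cone_ll_def cone_le_def)
qed

lemma istopology_natural:
  assumes P: "ordering_cone P" and I: "interior P \<noteq> {}"
  shows "istopology
    (\<lambda>U. U \<subseteq> X \<and> (\<forall>x\<in>U. \<exists>c. cone_ll P 0 c \<and> cone_ball P X d x c \<subseteq> U))"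
  unfolding istopology_def
proof (intro conjI allI impI)
  fix S T
  assume S: "S \<subseteq> X \<and> (\<forall>x\<in>S. \<exists>c. cone_ll P 0 c \<and> cone_ball P X d x c \<subseteq> S)"
    and T: "T \<subseteq> X \<and> (\<forall>x\<in>T. \<exists>c. cone_ll P 0 c \<and> cone_ball P X d x c \<subseteq> T)"
  then show "S \<inter> T \<subseteq> X" by blast
  have mono: "cone_ball P X d x f \<subseteq> cone_ball P X d x c" if "cone_le P f c" for x f c
  proof
    fix y assume "y \<in> cone_ball P X d x f"
    moreover have "(f - d x y) + (c - f) \<in> interior P" if "f - d x y \<in> interior P"
      using interior_cone_add[OF P that, of "c - f"] \<open>cone_le P f c\<close>
      unfolding cone_le_def by blast
    ultimately show "y \<in> cone_ball P X d x c"
      by (auto simp: cone_ball_def cone_ll_def)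
  qed
  show "\<forall>x\<in>S \<inter> T. \<exists>c. cone_ll P 0 c \<and> cone_ball P X d x c \<subseteq> S \<inter> T"
  proof
    fix x assume "x \<in> S \<inter> T"
    then obtain c e where "cone_ll P 0 c" "cone_ball P X d x c \<subseteq> S"
      "cone_ll P 0 e" "cone_ball P X d x e \<subseteq> T"
      using S T by blast
    then show "\<exists>c. cone_ll P 0 c \<and> cone_ball P X d x c \<subseteq> S \<inter> T"
      using cone_ll_common_lower[OF P, of c e] mono by (meson Int_greatest order_trans)
  qed
next
  fix \<K>
  assume "\<forall>K\<in>\<K>. K \<subseteq> X \<and> (\<forall>x\<in>K. \<exists>c. cone_ll P 0 c \<and> cone_ball P X d x c \<subseteq> K)"
  then show "\<Union>\<K> \<subseteq> X"
    and "\<forall>x\<in>\<Union>\<K>. \<exists>c. cone_ll P 0 c \<and> cone_ball P X d x c \<subseteq> \<Union>\<K>"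
    by (blast, meson Union_iff Union_upper order_trans)
qed

lemma openin_natural_topology:
  assumes "ordering_cone P" and "interior P \<noteq> {}"
  shows "openin (natural_topology P X d) U \<longleftrightarrow>
    U \<subseteq> X \<and> (\<forall>x\<in>U. \<exists>c. cone_ll P 0 c \<and> cone_ball P X d x c \<subseteq> U)"
  unfolding natural_topology_def
  by (simp add: topology_inverse'[OF istopology_natural[OF assms]])

lemma topspace_natural_topology:
  assumes "ordering_cone P" and "interior P \<noteq> {}"
  shows "topspace (natural_topology P X d) = X"
proof -
  have "openin (natural_topology P X d) X"
    using assms by (auto simp: openin_natural_topology cone_ball_def cone_ll_def)
  then show ?thesis
    using openin_subset openin_topspace openin_natural_topology[OF assms]
    by (metis subset_antisym)
qed

end

theory Submission
  imports Defs
begin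

text \<open>
  Along an orbit \<open>x\<^sub>n = T\<^sup>n x\<^sub>0\<close> consecutive distances decay geometrically:
  \<open>d x\<^sub>n x\<^sub>n\<^sub>+\<^sub>1 \<preceq> k\<^sup>n u\<close> with \<open>u = d x\<^sub>0 x\<^sub>1\<close>.  The relaxed triangle inequality costs a factor
  \<open>\<eta>\<close> each time it is applied, so summing these estimates naively produces products of values
  of \<open>\<eta>\<close>.  The hypothesis on the double limit supplies a single number \<open>M\<close> with \<open>k M < 1\<close> that
  bounds \<open>\<eta>\<close> on a tail of the orbit.  Splitting off only the first step,
  \<open>d x\<^sub>n x\<^sub>m \<preceq> M (d x\<^sub>n x\<^sub>n\<^sub>+\<^sub>1 + d x\<^sub>n\<^sub>+\<^sub>1 x\<^sub>m)\<close>, a bound \<open>C k\<^sup>n u\<close> reproduces itself as soon as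
  \<open>M + C k M = C\<close>, that is, for \<open>C = M / (1 - k M)\<close>.  This is the lemma
  \<open>contraction_orbit_bound\<close>; it makes the orbit Cauchy, hence convergent to some \<open>a\<close>.

  Because \<open>d (T x) (T y) \<preceq> d x y\<close>, the shifted orbit converges to \<open>T a\<close> as well.  Limits are
  unique (\<open>cone_limit_unique\<close>): for two limits \<open>a\<close>, \<open>b\<close> the triangle inequality involves only the
  one number \<open>\<eta> a b\<close>, while the remaining distances are arbitrarily small.  Hence \<open>T a = a\<close>.
  Finally \<open>d a b \<preceq> k d a b\<close> with \<open>k < 1\<close> forces two fixed points to coincide, so all orbits
  have the same limit.
\<close>

section \<open>The order of a solid cone\<close>

lemma ordering_cone_scaleR:
  assumes "ordering_cone P" "x \<in> P" "0 \<le> a"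
  shows "a *\<^sub>R x \<in> P"
proof -
  have "a *\<^sub>R x + 0 *\<^sub>R x \<in> P"
    using assms unfolding ordering_cone_def by (meson order_refl)
  then show ?thesis by simp
qed

lemma ordering_cone_add:
  assumes "ordering_cone P" "x \<in> P" "y \<in> P"
  shows "x + y \<in> P"
proof -
  have "1 *\<^sub>R x + 1 *\<^sub>R y \<in> P"
    using assms unfolding ordering_cone_def by (meson zero_le_one)
  then show ?thesis by simp
qed

lemma cone_le_trans:
  assumes "ordering_cone P" "cone_le P x y" "cone_le P y z"
  shows "cone_le P x z"
  using ordering_cone_add[of P "y - x" "z - y"] assms by (simp add: cone_le_def)

lemma cone_le_add_mono:
  assumes "ordering_cone P" "cone_le P x y" "cone_le P x' y'"
  shows "cone_le P (x + x') (y + y')"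
  using ordering_cone_add[of P "y - x" "y' - x'"] assms
  by (simp add: cone_le_def algebra_simps)

lemma cone_le_scaleR_left_mono:
  assumes "ordering_cone P" "cone_le P x y" "0 \<le> a"
  shows "cone_le P (a *\<^sub>R x) (a *\<^sub>R y)"
  using ordering_cone_scaleR[of P "y - x" a] assms by (simp add: cone_le_def algebra_simps)

lemma cone_le_scaleR_right_mono:
  assumes "ordering_cone P" "cone_le P 0 x" "a \<le> b"
  shows "cone_le P (a *\<^sub>R x) (b *\<^sub>R x)"
  using ordering_cone_scaleR[of P x "b - a"] assms by (simp add: cone_le_def algebra_simps)

lemma cone_le_ll_trans:
  assumes "ordering_cone P" "cone_le P x y" "cone_ll P y z"
  shows "cone_ll P x z"
  using interior_cone_add[of P "z - y" "y - x"] assms by (simp add: cone_ll_def cone_le_def)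

lemma cone_ll_imp_le: "cone_ll P x y \<Longrightarrow> cone_le P x y"
  using interior_subset by (auto simp: cone_ll_def cone_le_def)

lemma cone_ll_0_scaleR:
  assumes P: "ordering_cone P" and c: "cone_ll P 0 c" and a: "0 < a"
  shows "cone_ll P 0 (a *\<^sub>R c)"
proof -
  have "(\<lambda>x. a *\<^sub>R x) ` interior P \<subseteq> P"
    using ordering_cone_scaleR[OF P] a interior_subset by fastforce
  moreover have "open ((\<lambda>x. a *\<^sub>R x) ` interior P)"
    using a by (intro open_scaling) auto
  ultimately have "(\<lambda>x. a *\<^sub>R x) ` interior P \<subseteq> interior P"
    by (rule interior_maximal)
  then show ?thesis using c by (auto simp: cone_ll_def)
qed

text \<open>Norm convergence to zero implies convergence in the sense of \<open>\<lless>\<close>, because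
  \<open>c \<ggreater> 0\<close> has a norm neighbourhood inside the cone.\<close>

lemma eventually_cone_ll:
  assumes "(f \<longlongrightarrow> 0) F" "cone_ll P 0 c"
  shows "\<forall>\<^sub>F i in F. cone_ll P (f i) c"
proof -
  have "((\<lambda>i. c - f i) \<longlongrightarrow> c - 0) F"
    using assms by (intro tendsto_intros)
  then show ?thesis
    using assms(2) unfolding cone_ll_def by (auto dest!: topological_tendstoD[OF _ open_interior])
qed

text \<open>Closedness of the cone passes \<open>x \<preceq> f i\<close> to the limit \<open>x \<preceq> 0\<close>.\<close>

lemma cone_le_null_imp_zero:
  assumes P: "ordering_cone P" and x: "cone_le P 0 x"
    and le: "\<And>i. cone_le P x (f i)" and f: "f \<longlonglongrightarrow> 0"
  shows "x = 0"
proof -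
  have lim: "(\<lambda>i. f i - x) \<longlonglongrightarrow> 0 - x"
    using f by (intro tendsto_intros)
  have "closed P" using P by (simp add: ordering_cone_def)
  moreover have "f i - x \<in> P" for i using le by (simp add: cone_le_def)
  ultimately have "0 - x \<in> P" by (rule closed_sequentially[OF _ _ lim])
  then show ?thesis
    using P x by (simp add: ordering_cone_def cone_le_def)
qed

section \<open>Uniqueness of limits\<close>

lemma eta_cone_metricD:
  assumes "eta_cone_metric P X \<eta> d" "x \<in> X" "y \<in> X"
  shows "1 \<le> \<eta> x y" "cone_le P 0 (d x y)" "d x y = 0 \<longleftrightarrow> x = y" "d x y = d y x"
    "z \<in> X \<Longrightarrow> cone_le P (d x z) (\<eta> x z *\<^sub>R (d x y + d y z))"
  using assms by (auto simp: eta_cone_metric_def)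

lemma cone_limit_unique:
  assumes P: "ordering_cone P" and I: "interior P \<noteq> {}"
    and m: "eta_cone_metric P X \<eta> d"
    and s: "\<And>n. s n \<in> X" and a: "a \<in> X" and b: "b \<in> X"
    and sa: "cone_converges P d s a" and sb: "cone_converges P d s b"
  shows "a = b"
proof -
  obtain c where c: "cone_ll P 0 c" using I by (auto simp: cone_ll_def)
  define f where "f i = \<eta> a b *\<^sub>R (inverse (real (Suc i)) *\<^sub>R c + inverse (real (Suc i)) *\<^sub>R c)" for i
  have "cone_le P (d a b) (f i)" for i
  proof -
    let ?e = "inverse (real (Suc i)) *\<^sub>R c"
    have "cone_ll P 0 ?e" using cone_ll_0_scaleR[OF P c] by simp
    then obtain n1 n2 where n1: "\<forall>n\<ge>n1. cone_ll P (d (s n) a) ?e"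
      and n2: "\<forall>n\<ge>n2. cone_ll P (d (s n) b) ?e"
      using sa sb unfolding cone_converges_def by meson
    define n where "n = max n1 n2"
    have "cone_le P (d a (s n)) ?e" "cone_le P (d (s n) b) ?e"
      using cone_ll_imp_le[OF n1[rule_format, of n]] cone_ll_imp_le[OF n2[rule_format, of n]]
        eta_cone_metricD(4)[OF m a s[of n]] by (simp_all add: n_def)
    then have "cone_le P (\<eta> a b *\<^sub>R (d a (s n) + d (s n) b)) (f i)"
      unfolding f_def using eta_cone_metricD(1)[OF m a b]
      by (intro cone_le_scaleR_left_mono[OF P] cone_le_add_mono[OF P]) auto
    then show ?thesis
      using eta_cone_metricD(5)[OF m a s b] cone_le_trans[OF P] by blast
  qed
  moreover have "f \<longlonglongrightarrow> \<eta> a b *\<^sub>R (0 *\<^sub>R c + 0 *\<^sub>R c)"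
    unfolding f_def by (intro tendsto_intros LIMSEQ_inverse_real_of_nat)
  ultimately have "d a b = 0"
    using cone_le_null_imp_zero[OF P eta_cone_metricD(2)[OF m a b], of f] by simp
  then show ?thesis using eta_cone_metricD(3)[OF m a b] by simp
qed

section \<open>Orbits of a contraction\<close>

lemma funpow_mem: "T \<in> X \<rightarrow> X \<Longrightarrow> x \<in> X \<Longrightarrow> (T ^^ n) x \<in> X"
  by (induction n) auto

lemma contraction_step_bound:
  assumes P: "ordering_cone P" and T: "T \<in> X \<rightarrow> X" and k: "0 \<le> k"
    and contr: "\<forall>x\<in>X. \<forall>y\<in>X. cone_le P (d (T x) (T y)) (k *\<^sub>R d x y)"
    and x: "x \<in> X"
  shows "cone_le P (d ((T ^^ n) x) ((T ^^ Suc n) x)) (k ^ n *\<^sub>R d x (T x))"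
proof (induction n)
  case 0
  obtain z where "z \<in> P" using P by (auto simp: ordering_cone_def)
  then show ?case using ordering_cone_scaleR[OF P, of z 0] by (simp add: cone_le_def)
next
  case (Suc n)
  have "cone_le P (d ((T ^^ Suc n) x) ((T ^^ Suc (Suc n)) x))
          (k *\<^sub>R d ((T ^^ n) x) ((T ^^ Suc n) x))"
    using contr funpow_mem[OF T x, of n] funpow_mem[OF T x, of "Suc n"] by simp
  moreover have "cone_le P (k *\<^sub>R d ((T ^^ n) x) ((T ^^ Suc n) x)) (k *\<^sub>R (k ^ n *\<^sub>R d x (T x)))"
    using cone_le_scaleR_left_mono[OF P Suc.IH k] .
  ultimately show ?case using cone_le_trans[OF P] by fastforce
qed

text \<open>The induction peels off the step from \<open>x\<^sub>n\<close> to \<open>x\<^sub>n\<^sub>+\<^sub>1\<close> and is uniform in \<open>n\<close>, so the induction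
  hypothesis applies at \<open>n + 1\<close> and contributes one more factor \<open>k\<close>.  That factor compensates the
  factor \<open>M\<close> of the triangle inequality, and the constant \<open>M / (1 - k M)\<close> is the fixed point of
  \<open>C \<mapsto> M + k M C\<close>.\<close>

lemma contraction_orbit_bound:
  assumes P: "ordering_cone P" and m: "eta_cone_metric P X \<eta> d"
    and T: "T \<in> X \<rightarrow> X" and k: "0 \<le> k"
    and contr: "\<forall>x\<in>X. \<forall>y\<in>X. cone_le P (d (T x) (T y)) (k *\<^sub>R d x y)"
    and x: "x \<in> X"
    and M: "\<And>n m. N \<le> n \<Longrightarrow> N \<le> m \<Longrightarrow> \<eta> ((T ^^ n) x) ((T ^^ m) x) \<le> M" and kM: "k * M < 1"
    and n: "N \<le> n"
  shows "cone_le P (d ((T ^^ n) x) ((T ^^ (n + p)) x)) ((M / (1 - k * M) * k ^ n) *\<^sub>R d x (T x))"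
proof -
  have orb: "(T ^^ n) x \<in> X" for n by (rule funpow_mem[OF T x])
  have u: "cone_le P 0 (d x (T x))"
    using eta_cone_metricD(2)[OF m] T x by auto
  have M1: "1 \<le> M"
    using eta_cone_metricD(1)[OF m orb orb] M by (meson order_refl order_trans)
  define C where "C = M / (1 - k * M)"
  have C0: "0 \<le> C" and C: "M + M * (C * k) = C"
    using M1 kM by (auto simp: C_def field_simps)
  show ?thesis
    using n
  proof (induction p arbitrary: n)
    case 0
    have "d ((T ^^ n) x) ((T ^^ n) x) = 0"
      using eta_cone_metricD(3)[OF m orb orb] by simp
    then show ?case
      using cone_le_scaleR_right_mono[OF P u, of 0 "C * k ^ n"] C0 k by (simp flip: C_def)
  next
    case (Suc p)
    let ?x = "\<lambda>n. (T ^^ n) x"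
    let ?s = "d (?x n) (?x (Suc n)) + d (?x (Suc n)) (?x (n + Suc p))"
    have tri: "cone_le P (d (?x n) (?x (n + Suc p))) (\<eta> (?x n) (?x (n + Suc p)) *\<^sub>R ?s)"
      by (rule eta_cone_metricD(5)[OF m orb orb orb])
    have "cone_le P (0 + 0) ?s"
      by (intro cone_le_add_mono[OF P] eta_cone_metricD(2)[OF m] orb)
    then have grow: "cone_le P (\<eta> (?x n) (?x (n + Suc p)) *\<^sub>R ?s) (M *\<^sub>R ?s)"
      using M[of n "n + Suc p"] Suc.prems by (intro cone_le_scaleR_right_mono[OF P]) simp_all
    have "cone_le P (d (?x (Suc n)) (?x (n + Suc p))) ((C * k ^ Suc n) *\<^sub>R d x (T x))"
      using Suc.IH[of "Suc n"] Suc.prems by (simp add: C_def)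
    then have "cone_le P ?s (k ^ n *\<^sub>R d x (T x) + (C * k ^ Suc n) *\<^sub>R d x (T x))"
      by (rule cone_le_add_mono[OF P contraction_step_bound[OF P T k contr x]])
    then have "cone_le P (M *\<^sub>R ?s)
        (M *\<^sub>R (k ^ n *\<^sub>R d x (T x) + (C * k ^ Suc n) *\<^sub>R d x (T x)))"
      using M1 by (intro cone_le_scaleR_left_mono[OF P]) auto
    also have "M *\<^sub>R (k ^ n *\<^sub>R d x (T x) + (C * k ^ Suc n) *\<^sub>R d x (T x))
        = ((M + M * (C * k)) * k ^ n) *\<^sub>R d x (T x)"
      by (simp add: algebra_simps)
    finally have "cone_le P (M *\<^sub>R ?s) ((C * k ^ n) *\<^sub>R d x (T x))"
      by (simp only: C)
    with cone_le_trans[OF P tri grow] show ?case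
      unfolding C_def by (rule cone_le_trans[OF P])
  qed
qed

lemma contraction_orbit_Cauchy:
  assumes P: "ordering_cone P" and m: "eta_cone_metric P X \<eta> d"
    and T: "T \<in> X \<rightarrow> X" and k: "0 \<le> k" "k < 1"
    and contr: "\<forall>x\<in>X. \<forall>y\<in>X. cone_le P (d (T x) (T y)) (k *\<^sub>R d x y)"
    and x: "x \<in> X"
    and M: "\<And>n m. N \<le> n \<Longrightarrow> N \<le> m \<Longrightarrow> \<eta> ((T ^^ n) x) ((T ^^ m) x) \<le> M" and kM: "k * M < 1"
  shows "cone_Cauchy P d (\<lambda>n. (T ^^ n) x)"
  unfolding cone_Cauchy_def
proof (intro allI impI)
  fix c assume c: "cone_ll P 0 c"
  let ?x = "\<lambda>n. (T ^^ n) x"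
  let ?b = "\<lambda>n. (M / (1 - k * M) * k ^ n) *\<^sub>R d x (T x)"
  have "?b \<longlonglongrightarrow> (M / (1 - k * M) * 0) *\<^sub>R d x (T x)"
    using k by (intro tendsto_intros LIMSEQ_power_zero) auto
  then have "\<forall>\<^sub>F n in sequentially. cone_ll P (?b n) c"
    using c by (intro eventually_cone_ll) auto
  then obtain n1 where n1: "\<And>n. n1 \<le> n \<Longrightarrow> cone_ll P (?b n) c"
    by (auto simp: eventually_sequentially)
  have le: "cone_ll P (d (?x n) (?x m)) c" if "max N n1 \<le> n" "n \<le> m" for n m
  proof (rule cone_le_ll_trans[OF P])
    have "cone_le P (d (?x n) (?x (n + (m - n)))) (?b n)"
      using that by (intro contraction_orbit_bound[OF P m T k(1) contr x M kM, where N = N]) auto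
    then show "cone_le P (d (?x n) (?x m)) (?b n)" using that by simp
    show "cone_ll P (?b n) c" using n1 that by simp
  qed
  have "cone_ll P (d (?x n) (?x m)) c" if "max N n1 \<le> n" "max N n1 \<le> m" for n m
  proof (cases "n \<le> m")
    case True
    then show ?thesis using le that by blast
  next
    case False
    then have "cone_ll P (d (?x m) (?x n)) c" using le that by simp
    then show ?thesis
      using eta_cone_metricD(4)[OF m funpow_mem[OF T x] funpow_mem[OF T x], of n m] by simp
  qed
  then show "\<exists>n0. \<forall>n\<ge>n0. \<forall>m\<ge>n0. cone_ll P (d (?x n) (?x m)) c"
    by (intro exI[of _ "max N n1"]) auto
qed

text \<open>The condition \<open>k > 0 \<longrightarrow> L < 1 / k\<close> says \<open>k L < 1\<close>; this leaves room for a bound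
  slightly above \<open>L\<close>.\<close>

lemma tendsto_imp_eventual_bound:
  fixes e :: "nat \<Rightarrow> nat \<Rightarrow> real"
  assumes lim: "((\<lambda>(n, m). e n m) \<longlongrightarrow> L) (sequentially \<times>\<^sub>F sequentially)"
    and k: "0 \<le> k" and L: "k > 0 \<longrightarrow> L < 1 / k"
  obtains M N where "k * M < 1" "\<And>n m. N \<le> n \<Longrightarrow> N \<le> m \<Longrightarrow> e n m \<le> M"
proof -
  obtain M where LM: "L < M" and kM: "k * M < 1"
  proof (cases "k = 0")
    case True
    then show ?thesis using that[of "L + 1"] by simp
  next
    case False
    then obtain M where "L < M" "M < 1 / k" using L k dense[of L "1 / k"] by auto
    then show ?thesis using that[of M] False k by (simp add: field_simps)
  qed
  have "\<forall>\<^sub>F (n, m) in sequentially \<times>\<^sub>F sequentially. e n m < M"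
    using order_tendstoD(2)[OF lim LM] by (simp add: case_prod_unfold)
  then obtain N where "\<forall>n\<ge>N. \<forall>m\<ge>N. e n m < M"
    by (auto simp: eventually_prod_sequentially)
  then show ?thesis using that[OF kM, of N] by (simp add: less_imp_le)
qed

lemma contraction_limit_fixed:
  assumes P: "ordering_cone P" and I: "interior P \<noteq> {}" and m: "eta_cone_metric P X \<eta> d"
    and T: "T \<in> X \<rightarrow> X" and k: "k \<le> 1"
    and contr: "\<forall>x\<in>X. \<forall>y\<in>X. cone_le P (d (T x) (T y)) (k *\<^sub>R d x y)"
    and x: "x \<in> X" and a: "a \<in> X" and lim: "cone_converges P d (\<lambda>n. (T ^^ n) x) a"
  shows "T a = a"
proof (rule cone_limit_unique[OF P I m])
  show "(T ^^ Suc n) x \<in> X" for n by (rule funpow_mem[OF T x])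
  show "T a \<in> X" using T a by auto
  show "a \<in> X" by (rule a)
  show "cone_converges P d (\<lambda>n. (T ^^ Suc n) x) a"
    using lim unfolding cone_converges_def by (meson le_SucI)
  have le: "cone_le P (d ((T ^^ Suc n) x) (T a)) (d ((T ^^ n) x) a)" for n
  proof -
    have "cone_le P (d ((T ^^ Suc n) x) (T a)) (k *\<^sub>R d ((T ^^ n) x) a)"
      using contr a funpow_mem[OF T x, of n] by simp
    moreover have "cone_le P (k *\<^sub>R d ((T ^^ n) x) a) (1 *\<^sub>R d ((T ^^ n) x) a)"
      using cone_le_scaleR_right_mono[OF P eta_cone_metricD(2)[OF m funpow_mem[OF T x] a] k] .
    ultimately show ?thesis using cone_le_trans[OF P] by fastforce
  qed
  show "cone_converges P d (\<lambda>n. (T ^^ Suc n) x) (T a)"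
    using lim cone_le_ll_trans[OF P le] unfolding cone_converges_def by meson
qed

lemma contraction_fixed_point_unique:
  assumes P: "ordering_cone P" and m: "eta_cone_metric P X \<eta> d" and k: "k < 1"
    and contr: "\<forall>x\<in>X. \<forall>y\<in>X. cone_le P (d (T x) (T y)) (k *\<^sub>R d x y)"
    and a: "a \<in> X" "T a = a" and b: "b \<in> X" "T b = b"
  shows "a = b"
proof -
  have "cone_le P (d a b) (k *\<^sub>R d a b)" using contr a b by metis
  then have "(k - 1) *\<^sub>R d a b \<in> P" by (simp add: cone_le_def algebra_simps)
  then have "inverse (1 - k) *\<^sub>R ((k - 1) *\<^sub>R d a b) \<in> P"
    using k by (simp add: ordering_cone_scaleR[OF P] del: scaleR_scaleR)
  moreover have "inverse (1 - k) * (k - 1) = - 1" using k by (simp add: field_simps)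
  ultimately have "- d a b \<in> P" by (simp only: scaleR_scaleR scaleR_minus1_left)
  then have "d a b = 0"
    using P eta_cone_metricD(2)[OF m a(1) b(1)] by (simp add: ordering_cone_def cone_le_def)
  then show ?thesis using eta_cone_metricD(3)[OF m a(1) b(1)] by simp
qed

section \<open>The fixed point theorem\<close>

theorem theorem4p2:
  fixes P :: "'e::banach set" and K :: real
    and X :: "'a set" and \<eta> :: "'a \<Rightarrow> 'a \<Rightarrow> real" and d :: "'a \<Rightarrow> 'a \<Rightarrow> 'e"
    and T :: "'a \<Rightarrow> 'a" and k :: real
  assumes "normal_cone P" and "is_normal_constant P K" and "interior P \<noteq> {}"
    and "eta_cone_metric P X \<eta> d"
    and "cone_complete P X d"
    and "cone_metric_continuous P X d"
    and "T \<in> X \<rightarrow> X"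
    and "0 \<le> k" and "k < 1"
    and "\<forall>x\<in>X. \<forall>y\<in>X. cone_le P (d (T x) (T y)) (k *\<^sub>R d x y)"
    and "\<forall>x0\<in>X. \<exists>L::real.
           ((\<lambda>(n, m). \<eta> ((T ^^ n) x0) ((T ^^ m) x0)) \<longlongrightarrow> L) (sequentially \<times>\<^sub>F sequentially)
           \<and> (k > 0 \<longrightarrow> L < 1 / k)"
  shows "\<exists>xs\<in>X. T xs = xs \<and> (\<forall>y\<in>X. T y = y \<longrightarrow> y = xs) \<and>
           (\<forall>x\<in>X. cone_converges P d (\<lambda>n. (T ^^ n) x) xs)"
proof -
  have P: "ordering_cone P" using assms(1) by (simp add: normal_cone_def)
  note I = assms(3) and m = assms(4) and T = assms(7) and k = assms(8,9) and contr = assms(10)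
  have orbit: "\<exists>a\<in>X. T a = a \<and> cone_converges P d (\<lambda>n. (T ^^ n) x) a" if x: "x \<in> X" for x
  proof -
    obtain L where lim: "((\<lambda>(n, m). \<eta> ((T ^^ n) x) ((T ^^ m) x)) \<longlongrightarrow> L)
        (sequentially \<times>\<^sub>F sequentially)" and L: "k > 0 \<longrightarrow> L < 1 / k"
      using assms(11) x by blast
    obtain M N where kM: "k * M < 1"
      and M: "\<And>n m. N \<le> n \<Longrightarrow> N \<le> m \<Longrightarrow> \<eta> ((T ^^ n) x) ((T ^^ m) x) \<le> M"
      using tendsto_imp_eventual_bound[OF lim k(1) L] by metis
    have "cone_Cauchy P d (\<lambda>n. (T ^^ n) x)"
      by (rule contraction_orbit_Cauchy[OF P m T k contr x M kM])
    then obtain a where a: "a \<in> X" "cone_converges P d (\<lambda>n. (T ^^ n) x) a"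
      using assms(5) funpow_mem[OF T x] unfolding cone_complete_def by meson
    then show ?thesis
      using contraction_limit_fixed[OF P I m T less_imp_le[OF k(2)] contr x] by blast
  qed
  have unique: "a = b" if "a \<in> X" "T a = a" "b \<in> X" "T b = b" for a b
    by (rule contraction_fixed_point_unique[OF P m k(2) contr that])
  obtain x0 where "x0 \<in> X" using m by (auto simp: eta_cone_metric_def)
  then obtain a where "a \<in> X" "T a = a" using orbit by blast
  then show ?thesis using orbit unique by metis
qed

end
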